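(* Consider the problem $z^*=\min_{\bm{x}\in\mathcal{X}}\{f(\bm{x})\mid \bm{g}(\bm{x})=\bm{0}\}$ with $\bm{x}=(x_1,\ldots,x_n)$, $\bm{g}=(g_1,\ldots,g_m)$, and its Lagrangian relaxation $\theta(\bm{\lambda})=\min_{\bm{x}\in\mathcal{X}}\{f(\bm{x})+\bm{\lambda}^T\bm{g}(\bm{x})\}$, $\bm{\lambda}\in\mathbb{R}^m$, where the problem is represented by a dynamic programming model whose relaxed recursion has states $\bar{\bm{S}}_i$. Suppose there are immediate cost functions $\bar c_i(\bar{\bm{S}}_i^K,x_i)$ with $f(\bm{x})=\sum_{i=1}^n \bar c_i(\bar{\bm{S}}_i^K,x_i)$ and vector-valued immediate penalty functions $\bm{\gamma}_i(\bar{\bm{S}}_i^L,x_i)$ with $\bm{g}(\bm{x})=\sum_{i=1}^n\bm{\gamma}_i(\bar{\bm{S}}_i^L,x_i)$, where $\bar{\bm{S}}_i^K$ and $\bar{\bm{S}}_i^L$ consist entirely of exact state variables of $\bar{\bm{S}}_i$. Then the Lagrangian relaxation can be implemented in the relaxed decision diagram, and the recursion for computing shortest paths in the relaxed DD becomes \[ \bar h_i(\bar{\bm{S}}_i,\bm{\lambda})=\min_{x_i\in X_i(\bar{\bm{S}}_i)}\Big\{\bar c_i(\bar{\bm{S}}_i^K,x_i)+\bm{\lambda}^T\bm{\gamma}_i(\bar{\bm{S}}_i^L,x_i)+\bar h_{i+1}\big(\rho_{i+1}(\phi_i(\bar{\bm{S}}_i,x_i)),\bm{\lambda}\big)\Big\}.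 \]
   Context: A dynamic programming model has recursion $h_i(\bm{S}_i)=\min_{x_i\in X_i(\bm{S}_i)}\{c_i(\bm{S}_i,x_i)+h_{i+1}(\phi_i(\bm{S}_i,x_i))\}$ with state $\bm{S}_i$ (a tuple of state variables), feasible control set $X_i(\bm{S}_i)$, transition function $\phi_i$, immediate cost $c_i$, single initial state $\bm{S}_1$ and single final state $\bm{S}_{n+1}$ with $h_{n+1}(\bm{S}_{n+1})=0$. Its decision diagram (DD) has a node for each state in layer $i$, and an arc with label $v$ from the node of $\bm{S}_i$ to the node of $\phi_i(\bm{S}_i,v)$ for each $v\in X_i(\bm{S}_i)$; $r$–$t$ paths correspond to assignments $\bm{x}$. A relaxed DD is obtained by merging nodes within layers (merged nodes receive a state $\bm{S}\oplus\bm{T}$), giving the relaxed recursion $\bar h_i(\bar{\bm{S}}_i)=\min_{x_i\in X_i(\bar{\bm{S}}_i)}\{c_i(\bar{\bm{S}}_i,x_i)+\bar h_{i+1}(\rho_{i+1}(\phi_i(\bar{\bm{S}}_i,x_i)))\}$, where $\bar{\bm{S}}_i$ is a possibly enlarged state vector and $\rho_{i+1}$ maps a state to the merged state of its node in stage $i+1$. A state variable $S_{ij}$ of the relaxed recursion is exact if any sequence of controls $x_1,\ldots,x_{i-1}$ leading to a given value of $S_{ij}$ in the original recursion leads to the same value in the relaxed recursion. $\bar{\bm{S}}_i^K$ (resp. $\bar{\bm{S}}_i^L$) denotes the tuple of state variables $S_{i\ell}$, $\ell\in K$ (resp. $\ell\in L$), and in the sums the state variables are those reached by the path encoding $\bm{x}$.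 "Lagrangian relaxation can be implemented in a relaxed DD" means that with arc costs $\bar c_i+\bm{\lambda}^T\bm{\gamma}_i$ the length of each $r$–$t$ path of the relaxed DD equals $f(\bm{x})+\bm{\lambda}^T\bm{g}(\bm{x})$ for the assignment $\bm{x}$ it encodes, so shortest paths are computed by the displayed recursion. *)

theory Defs
  imports "HOL-Analysis.Analysis" "HOL-Library.Disjoint_Sets"
begin

section \<open>Dynamic programming models\<close>

text \<open>
  Stages are numbered from 0: controls are chosen at stages \<open>0, \<dots>, n - 1\<close>, where \<open>n\<close> is the
  horizon, and stage \<open>n\<close> is terminal. An assignment is a list of \<open>n\<close> controls.

  In the theorem a state is a function from state variables to values, and it is the enlarged
  state vector if state variables are added for the sake of the relaxation: the same feasible sets,
  costs and transitions are used with merging (relaxed recursion) and without (original recursion).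
\<close>

record ('s, 'x) dp =
  horizon :: nat
  init :: 's
  controls :: "nat \<Rightarrow> 's \<Rightarrow> 'x set"
  trans :: "nat \<Rightarrow> 's \<Rightarrow> 'x \<Rightarrow> 's"
  cost :: "nat \<Rightarrow> 's \<Rightarrow> 'x \<Rightarrow> real"

text \<open>
  \<open>\<rho> i\<close> sends a state arising at stage \<open>i\<close> to the state of the node that it is merged into.
  Transitions are total, so a state is reached by every control sequence, whether or not the
  controls are feasible.
\<close>

primrec reached :: "('s, 'x) dp \<Rightarrow> (nat \<Rightarrow> 's \<Rightarrow> 's) \<Rightarrow> 'x list \<Rightarrow> nat \<Rightarrow> 's" where
  "reached M \<rho> x 0 = init M"
| "reached M \<rho> x (Suc i) = \<rho> (Suc i) (trans M i (reached M \<rho> x i) (x ! i))"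

definition no_merging :: "nat \<Rightarrow> 's \<Rightarrow> 's" where
  "no_merging i S = S"

section \<open>Decision diagrams\<close>

text \<open>A node is identified by its layer and its state; an arc is (tail, label, head).\<close>

record ('s, 'x) dd =
  depth :: nat
  root :: 's
  layer :: "nat \<Rightarrow> 's set"
  arcs :: "nat \<Rightarrow> ('s \<times> 'x \<times> 's) set"

fun is_path :: "('s, 'x) dd \<Rightarrow> nat \<Rightarrow> 's \<Rightarrow> ('s \<times> 'x \<times> 's) list \<Rightarrow> bool" where
  "is_path D i S [] = (S \<in> layer D i)"
| "is_path D i S ((S', v, T) # p) = (S' = S \<and> (S, v, T) \<in> arcs D i \<and> is_path D (Suc i) T p)"

definition labels :: "('s \<times> 'x \<times> 's) list \<Rightarrow> 'x list" where
  "labels p = map (\<lambda>(S, v, T). v) p"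

definition paths_to_terminal :: "('s, 'x) dd \<Rightarrow> nat \<Rightarrow> 's \<Rightarrow> ('s \<times> 'x \<times> 's) list set" where
  "paths_to_terminal D i S = {p. is_path D i S p \<and> i + length p = depth D}"

definition rt_paths :: "('s, 'x) dd \<Rightarrow> ('s \<times> 'x \<times> 's) list set" where
  "rt_paths D = paths_to_terminal D 0 (root D)"

definition assignments :: "('s, 'x) dd \<Rightarrow> 'x list set" where
  "assignments D = labels ` rt_paths D"

definition single_terminal :: "('s, 'x) dd \<Rightarrow> bool" where
  "single_terminal D \<longleftrightarrow> (\<exists>t. layer D (depth D) \<subseteq> {t})"

definition path_length ::
    "(nat \<Rightarrow> 's \<Rightarrow> 'x \<Rightarrow> real) \<Rightarrow> nat \<Rightarrow> ('s \<times> 'x \<times> 's) list \<Rightarrow> real" where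
  "path_length w i p = (\<Sum>k<length p. case p ! k of (S, v, T) \<Rightarrow> w (i + k) S v)"

text \<open>
  The value is \<open>\<infinity>\<close> at any node from which the terminal node cannot be reached. Feasible control sets
  will be finite, so that every infimum over a nonempty set is a minimum.
\<close>

definition shortest ::
    "('s, 'x) dd \<Rightarrow> (nat \<Rightarrow> 's \<Rightarrow> 'x \<Rightarrow> real) \<Rightarrow> nat \<Rightarrow> 's \<Rightarrow> ereal" where
  "shortest D w i S = (INF p \<in> paths_to_terminal D i S. ereal (path_length w i p))"

section \<open>The exact and the relaxed diagram of a model\<close>

primrec dp_layer :: "('s, 'x) dp \<Rightarrow> (nat \<Rightarrow> 's \<Rightarrow> 's) \<Rightarrow> nat \<Rightarrow> 's set" where
  "dp_layer M \<rho> 0 = {init M}"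
| "dp_layer M \<rho> (Suc i) =
     {\<rho> (Suc i) (trans M i S v) | S v. S \<in> dp_layer M \<rho> i \<and> v \<in> controls M i S}"

definition dp_dd :: "('s, 'x) dp \<Rightarrow> (nat \<Rightarrow> 's \<Rightarrow> 's) \<Rightarrow> ('s, 'x) dd" where
  "dp_dd M \<rho> = \<lparr>depth = horizon M, root = init M, layer = dp_layer M \<rho>,
     arcs = (\<lambda>i. {(S, v, \<rho> (Suc i) (trans M i S v)) | S v.
                    i < horizon M \<and> S \<in> dp_layer M \<rho> i \<and> v \<in> controls M i S})\<rparr>"

abbreviation exact_dd :: "('s, 'x) dp \<Rightarrow> ('s, 'x) dd" where
  "exact_dd M \<equiv> dp_dd M no_merging"

definition dp_model :: "('s, 'x) dp \<Rightarrow> bool" where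
  "dp_model M \<longleftrightarrow>
     (\<forall>i < horizon M. \<forall>S. finite (controls M i S)) \<and> single_terminal (exact_dd M)"

inductive merge_of :: "('s \<Rightarrow> 's \<Rightarrow> 's) \<Rightarrow> 's set \<Rightarrow> 's \<Rightarrow> bool" for mrg where
  single: "merge_of mrg {S} S"
| join: "\<lbrakk>merge_of mrg A S; merge_of mrg B T; A \<inter> B = {}\<rbrakk> \<Longrightarrow> merge_of mrg (A \<union> B) (mrg S T)"

text \<open>
  The states that arise at stage \<open>i + 1\<close> from the nodes of layer \<open>i\<close> are partitioned into blocks, and
  all states of a block are replaced by a state obtained by successive merging of the block.
\<close>

definition merges_layers ::
    "('s, 'x) dp \<Rightarrow> ('s \<Rightarrow> 's \<Rightarrow> 's) \<Rightarrow> (nat \<Rightarrow> 's \<Rightarrow> 's) \<Rightarrow> bool" where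
  "merges_layers M mrg \<rho> \<longleftrightarrow>
     (\<forall>i < horizon M. \<exists>P.
        partition_on {trans M i S v | S v. S \<in> dp_layer M \<rho> i \<and> v \<in> controls M i S} P \<and>
        (\<forall>B \<in> P. \<exists>T. merge_of mrg B T \<and> (\<forall>S \<in> B. \<rho> (Suc i) S = T)))"

text \<open>
  A relaxed diagram encodes every assignment of the exact one, at no greater cost, and possibly
  other assignments.
\<close>

definition relaxed_by ::
    "('s, 'x) dp \<Rightarrow> ('s \<Rightarrow> 's \<Rightarrow> 's) \<Rightarrow> (nat \<Rightarrow> 's \<Rightarrow> 's) \<Rightarrow> bool" where
  "relaxed_by M mrg \<rho> \<longleftrightarrow>
     merges_layers M mrg \<rho> \<and> single_terminal (dp_dd M \<rho>) \<and>
     (\<forall>p \<in> rt_paths (exact_dd M). \<exists>q \<in> rt_paths (dp_dd M \<rho>).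
        labels q = labels p \<and> path_length (cost M) 0 q \<le> path_length (cost M) 0 p)"

text \<open>
  The control sequences range over the paths of the relaxed diagram. These include sequences that
  are infeasible in the original recursion, where the value of the state variable is determined by
  the transition functions alone.
\<close>

definition exact_var ::
    "('k \<Rightarrow> 'v, 'x) dp \<Rightarrow> (nat \<Rightarrow> ('k \<Rightarrow> 'v) \<Rightarrow> ('k \<Rightarrow> 'v)) \<Rightarrow> nat \<Rightarrow> 'k \<Rightarrow> bool" where
  "exact_var M \<rho> i j \<longleftrightarrow>
     (\<forall>p. is_path (dp_dd M \<rho>) 0 (init M) p \<and> length p = i \<longrightarrow>
        reached M no_merging (labels p) i j = reached M \<rho> (labels p) i j)"

section \<open>The optimization problem and its Lagrangian relaxation\<close>

definition represents ::
    "('s, 'x) dp \<Rightarrow> 'x list set \<Rightarrow> ('x list \<Rightarrow> real) \<Rightarrow> ('x list \<Rightarrow> real ^ 'm) \<Rightarrow> bool" where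
  "represents M X f g \<longleftrightarrow>
     assignments (exact_dd M) = {x \<in> X. g x = 0} \<and>
     (\<forall>p \<in> rt_paths (exact_dd M). f (labels p) = path_length (cost M) 0 p)"

definition lagrangian ::
    "'x list set \<Rightarrow> ('x list \<Rightarrow> real) \<Rightarrow> ('x list \<Rightarrow> real ^ 'm) \<Rightarrow> real ^ 'm \<Rightarrow> ereal" where
  "lagrangian X f g lam = (INF x \<in> X. ereal (f x + lam \<bullet> g x))"

text \<open>\<open>restrict S K\<close> is the subtuple of the state \<open>S\<close> formed by the state variables in \<open>K\<close>.\<close>

definition lagrangian_cost ::
    "(nat \<Rightarrow> ('k \<Rightarrow> 'v) \<Rightarrow> 'x \<Rightarrow> real) \<Rightarrow> (nat \<Rightarrow> ('k \<Rightarrow> 'v) \<Rightarrow> 'x \<Rightarrow> real ^ 'm) \<Rightarrow>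
     'k set \<Rightarrow> 'k set \<Rightarrow> real ^ 'm \<Rightarrow> nat \<Rightarrow> ('k \<Rightarrow> 'v) \<Rightarrow> 'x \<Rightarrow> real" where
  "lagrangian_cost cbar \<gamma> K L lam i S v =
     cbar i (restrict S K) v + lam \<bullet> \<gamma> i (restrict S L) v"

end

theory Submission
  imports Defs
begin

text \<open>
  A path of the relaxed diagram visits the states that its labels reach in the relaxed recursion.
  Exactness makes the subtuples of these states indexed by \<open>K\<close> and \<open>L\<close> agree with those reached in
  the original recursion, so the arc costs along the path add up to the objective and penalty terms
  of the assignment. The recursion is Bellman's principle: a path to the terminal node is a first
  arc followed by a path from its head.
\<close>

lemma reached_take: "i \<le> k \<Longrightarrow> reached M \<rho> (take k x) i = reached M \<rho> x i"
  by (induction i) auto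

lemma labels_take: "labels (take k p) = take k (labels p)"
  by (simp add: labels_def take_map)

lemma dp_dd_simps [simp]:
  "depth (dp_dd M \<rho>) = horizon M"
  "root (dp_dd M \<rho>) = init M"
  "layer (dp_dd M \<rho>) = dp_layer M \<rho>"
  "(S, v, T) \<in> arcs (dp_dd M \<rho>) i \<longleftrightarrow>
     i < horizon M \<and> S \<in> dp_layer M \<rho> i \<and> v \<in> controls M i S \<and> T = \<rho> (Suc i) (trans M i S v)"
  by (auto simp: dp_dd_def)

lemma is_path_start_in_layer: "is_path (dp_dd M \<rho>) i S p \<Longrightarrow> S \<in> dp_layer M \<rho> i"
  by (cases p) auto

text \<open>Serves to cut a root-to-terminal path down to a given stage. Cutting at
  \<open>k = 0\<close> leaves the empty path, which must still start at a node of its layer, hence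
  the appeal to \<open>is_path_start_in_layer\<close>.\<close>

lemma is_path_take: "is_path (dp_dd M \<rho>) i S p \<Longrightarrow> is_path (dp_dd M \<rho>) i S (take k p)"
proof (induction p arbitrary: i S k)
  case (Cons a p)
  then show ?case
    by (cases a; cases k) (auto dest: is_path_start_in_layer)
qed auto

text \<open>The tail and the label of an arc determine its head, and the next arc starts there. The
  start layer \<open>i\<close> is kept general because the induction drops the first arc and so
  moves to layer \<open>Suc i\<close>.\<close>

lemma is_path_nth_Suc:
  assumes "is_path (dp_dd M \<rho>) i S p" "Suc k < length p"
  shows "fst (p ! Suc k) = \<rho> (Suc (i + k)) (trans M (i + k) (fst (p ! k)) (labels p ! k))"
  using assms
proof (induction p arbitrary: i S k)
  case (Cons a p)
  show ?case
  proof (cases k)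
    case 0
    with Cons.prems show ?thesis
      by (cases a; cases p) (auto simp: labels_def)
  next
    case (Suc k')
    with Cons.prems show ?thesis
      using Cons.IH[of "Suc i" _ k'] by (cases a) (auto simp: labels_def)
  qed
qed simp

lemma is_path_nth_reached:
  assumes "is_path (dp_dd M \<rho>) 0 (init M) p" "k < length p"
  shows "fst (p ! k) = reached M \<rho> (labels p) k"
  using assms(2)
proof (induction k)
  case 0
  with assms(1) show ?case by (cases p) auto
next
  case (Suc k)
  then show ?case using is_path_nth_Suc[OF assms(1) Suc.prems] by simp
qed

text \<open>Heads do not enter arc costs, so only labels and tails matter; for paths from the root,
  \<open>is_path_nth_reached\<close> identifies the tails.\<close>

lemma path_length_conv_labels:
  "path_length w i p = (\<Sum>k<length p. w (i + k) (fst (p ! k)) (labels p ! k))"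
  unfolding path_length_def labels_def by (intro sum.cong) (auto split: prod.splits)

lemma path_length_Nil [simp]: "path_length w i [] = 0"
  by (simp add: path_length_def)

lemma path_length_Cons [simp]:
  "path_length w i ((S, v, T) # p) = w i S v + path_length w (Suc i) p"
  by (simp add: path_length_def sum.lessThan_Suc_shift del: sum.lessThan_Suc)

lemma rt_path_length_conv_reached:
  assumes "p \<in> rt_paths (dp_dd M \<rho>)"
  shows "path_length w 0 p =
    (\<Sum>i<horizon M. w i (reached M \<rho> (labels p) i) (labels p ! i))"
proof -
  have "is_path (dp_dd M \<rho>) 0 (init M) p" "length p = horizon M"
    using assms by (auto simp: rt_paths_def paths_to_terminal_def)
  then show ?thesis
    by (auto simp: path_length_conv_labels is_path_nth_reached intro!: sum.cong)
qed

text \<open>Exactness at stage \<open>i\<close> speaks of paths with exactly \<open>i\<close> arcs,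
  so the path is cut after \<open>i\<close> arcs. Nothing is lost, since by
  \<open>reached_take\<close> the state at stage \<open>i\<close> depends on the first
  \<open>i\<close> controls alone, in both recursions.\<close>

lemma exact_vars_restrict_reached:
  assumes "p \<in> rt_paths (dp_dd M \<rho>)" "i < horizon M" "\<forall>j \<in> J. exact_var M \<rho> i j"
  shows "restrict (reached M \<rho> (labels p) i) J = restrict (reached M no_merging (labels p) i) J"
proof -
  have p: "is_path (dp_dd M \<rho>) 0 (init M) (take i p)" "length (take i p) = i"
    using assms(1,2) by (auto simp: rt_paths_def paths_to_terminal_def intro: is_path_take)
  have "reached M no_merging (labels p) i j = reached M \<rho> (labels p) i j" if "j \<in> J" for j
    using p assms(3) that unfolding exact_var_def by (metis labels_take order_refl reached_take)
  \<comment> \<open>Outside \<open>J\<close> both restrictions are \<open>undefined\<close>, so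
    agreement on \<open>J\<close> makes them equal as functions.\<close>
  then show ?thesis by (auto simp: restrict_def)
qed

lemma paths_to_terminal_step:
  assumes "i < horizon M" "S \<in> dp_layer M \<rho> i"
  shows "paths_to_terminal (dp_dd M \<rho>) i S =
    (\<Union>v \<in> controls M i S. (#) (S, v, \<rho> (Suc i) (trans M i S v)) `
       paths_to_terminal (dp_dd M \<rho>) (Suc i) (\<rho> (Suc i) (trans M i S v)))"
    (is "?lhs = ?rhs")
proof (intro set_eqI iffI)
  fix p assume p: "p \<in> ?lhs"
  \<comment> \<open>The empty path ends in layer \<open>i\<close>, which lies before the terminal
    layer.\<close>
  with assms(1) have "p \<noteq> []" by (auto simp: paths_to_terminal_def)
  then obtain a q where "p = a # q" by (cases p) auto
  with p show "p \<in> ?rhs"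
    by (cases a) (auto simp: paths_to_terminal_def)
next
  fix p assume "p \<in> ?rhs"
  with assms show "p \<in> ?lhs" by (auto simp: paths_to_terminal_def)
qed

lemma INF_Union_distrib:
  "(INF x \<in> (\<Union>y \<in> A. B y). F x) = (INF y \<in> A. INF x \<in> B y. F x :: 'a :: complete_lattice)"
  by (rule order_antisym) (blast intro: INF_greatest INF_lower2)+

text \<open>A finite constant can be subtracted again, which gives the nontrivial inequality. The
  case of empty \<open>A\<close> is included, both sides then being infinite; it occurs at nodes
  with no path to the terminal layer.\<close>

lemma INF_ereal_real_add:
  fixes F :: "'a \<Rightarrow> ereal"
  shows "(INF x \<in> A. ereal c + F x) = ereal c + (INF x \<in> A. F x)"
proof (rule antisym)
  have "(INF x \<in> A. ereal c + F x) - ereal c \<le> F x" if "x \<in> A" for x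
    using INF_lower[OF that, of "\<lambda>x. ereal c + F x"]
    by (subst ereal_minus_le) (simp_all add: add.commute)
  then have "(INF x \<in> A. ereal c + F x) - ereal c \<le> (INF x \<in> A. F x)"
    by (rule INF_greatest)
  then show "(INF x \<in> A. ereal c + F x) \<le> ereal c + (INF x \<in> A. F x)"
    by (simp add: ereal_minus_le add.commute)
  show "ereal c + (INF x \<in> A. F x) \<le> (INF x \<in> A. ereal c + F x)"
    by (intro INF_greatest add_left_mono INF_lower)
qed

text \<open>The infimum over paths is taken first over the remaining path and then over the first
  label; the cost of the first arc is constant in the inner infimum.\<close>

lemma shortest_step:
  assumes "i < horizon M" "S \<in> dp_layer M \<rho> i"
  shows "shortest (dp_dd M \<rho>) w i S =
    (INF v \<in> controls M i S.
       ereal (w i S v) + shortest (dp_dd M \<rho>) w (Suc i) (\<rho> (Suc i) (trans M i S v)))"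
proof -
  \<comment> \<open>The sum is split in \<open>ereal\<close> so that
    \<open>INF_ereal_real_add\<close> applies; the deleted simp rules would merge it again or unfold
    the length too early.\<close>
  have "ereal (path_length w i ((S, v, T) # p)) =
      ereal (w i S v) + ereal (path_length w (Suc i) p)" for v T p
    by simp
  then show ?thesis
    unfolding shortest_def paths_to_terminal_step[OF assms]
    by (simp add: INF_Union_distrib image_image INF_ereal_real_add
             del: plus_ereal.simps path_length_Cons)
qed

lemma shortest_terminal:
  assumes "S \<in> dp_layer M \<rho> (horizon M)"
  shows "shortest (dp_dd M \<rho>) w (horizon M) S = 0"
proof -
  have "paths_to_terminal (dp_dd M \<rho>) (horizon M) S = {[]}"
    using assms by (auto simp: paths_to_terminal_def)
  then show ?thesis by (simp add: shortest_def zero_ereal_def)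
qed

text \<open>The shortest path minimizes over \<open>assignments R\<close> rather than
  \<open>X\<close>: a relaxed diagram is only guaranteed to contain the members of \<open>X\<close>
  with \<open>g x = 0\<close>. If it covers \<open>X\<close>, its shortest path bounds the
  Lagrangian relaxation over \<open>X\<close> from below.\<close>

theorem theorem2:
  fixes M :: "('k \<Rightarrow> 'v, 'x) dp"
    and mrg :: "('k \<Rightarrow> 'v) \<Rightarrow> ('k \<Rightarrow> 'v) \<Rightarrow> ('k \<Rightarrow> 'v)"
    and \<rho> :: "nat \<Rightarrow> ('k \<Rightarrow> 'v) \<Rightarrow> ('k \<Rightarrow> 'v)"
    and X :: "'x list set"
    and f :: "'x list \<Rightarrow> real"
    and g :: "'x list \<Rightarrow> real ^ 'm"
    and cbar :: "nat \<Rightarrow> ('k \<Rightarrow> 'v) \<Rightarrow> 'x \<Rightarrow> real"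
    and \<gamma> :: "nat \<Rightarrow> ('k \<Rightarrow> 'v) \<Rightarrow> 'x \<Rightarrow> real ^ 'm"
    and K L :: "'k set"
  defines "n \<equiv> horizon M"
    and "R \<equiv> dp_dd M \<rho>"
  assumes "dp_model M"
    and "represents M X f g"
    and "relaxed_by M mrg \<rho>"
    and "\<forall>i < n. \<forall>j \<in> K \<union> L. exact_var M \<rho> i j"
    and "\<forall>x \<in> assignments R.
           f x = (\<Sum>i<n. cbar i (restrict (reached M no_merging x i) K) (x ! i))"
    and "\<forall>x \<in> assignments R.
           g x = (\<Sum>i<n. \<gamma> i (restrict (reached M no_merging x i) L) (x ! i))"
  shows "\<forall>lam :: real ^ 'm.
    (let h = shortest R (lagrangian_cost cbar \<gamma> K L lam) in
      (\<forall>p \<in> rt_paths R.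
         path_length (lagrangian_cost cbar \<gamma> K L lam) 0 p = f (labels p) + lam \<bullet> g (labels p)) \<and>
      (\<forall>i < n. \<forall>S \<in> layer R i.
         h i S = (INF v \<in> controls M i S.
                    ereal (cbar i (restrict S K) v + lam \<bullet> \<gamma> i (restrict S L) v)
                    + h (Suc i) (\<rho> (Suc i) (trans M i S v)))) \<and>
      (\<forall>S \<in> layer R n. h n S = 0) \<and>
      h 0 (init M) = lagrangian (assignments R) f g lam \<and>
      (X \<subseteq> assignments R \<longrightarrow> h 0 (init M) \<le> lagrangian X f g lam))"
proof -
  have exact: "\<forall>j \<in> K. exact_var M \<rho> i j" "\<forall>j \<in> L. exact_var M \<rho> i j" if "i < n" for i
    using assms(6) that by auto
  have len: "path_length (lagrangian_cost cbar \<gamma> K L lam) 0 p = f (labels p) + lam \<bullet> g (labels p)"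
    if p: "p \<in> rt_paths R" for lam p
  proof -
    let ?x = "labels p"
    have x: "?x \<in> assignments R" using p by (simp add: assignments_def)
    have "path_length (lagrangian_cost cbar \<gamma> K L lam) 0 p =
        (\<Sum>i<n. lagrangian_cost cbar \<gamma> K L lam i (reached M \<rho> ?x i) (?x ! i))"
      using p rt_path_length_conv_reached unfolding R_def n_def by blast
    \<comment> \<open>Arc costs are evaluated at relaxed states, the sums for \<open>f\<close> and
      \<open>g\<close> at original ones; exactness exchanges the two under \<open>restrict\<close>,
      for \<open>K\<close> and \<open>L\<close> separately.\<close>
    also have "\<dots> = (\<Sum>i<n. cbar i (restrict (reached M no_merging ?x i) K) (?x ! i) +
        lam \<bullet> \<gamma> i (restrict (reached M no_merging ?x i) L) (?x ! i))"
      using p exact unfolding lagrangian_cost_def R_def n_def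
      by (intro sum.cong refl) (simp add: exact_vars_restrict_reached)
    also have "\<dots> = f ?x + lam \<bullet> g ?x"
      using assms(7,8) x by (simp add: sum.distrib inner_sum_right)
    finally show ?thesis .
  qed
  have dual: "shortest R (lagrangian_cost cbar \<gamma> K L lam) 0 (init M) =
      lagrangian (assignments R) f g lam" for lam
  proof -
    have "shortest R (lagrangian_cost cbar \<gamma> K L lam) 0 (init M) =
        (INF p \<in> rt_paths R. ereal (path_length (lagrangian_cost cbar \<gamma> K L lam) 0 p))"
      by (simp add: shortest_def rt_paths_def R_def)
    also have "\<dots> = (INF p \<in> rt_paths R. ereal (f (labels p) + lam \<bullet> g (labels p)))"
      by (intro INF_cong refl) (simp add: len)
    also have "\<dots> = lagrangian (assignments R) f g lam"
      by (simp add: lagrangian_def assignments_def image_image)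
    finally show ?thesis .
  qed
  have mono: "lagrangian (assignments R) f g lam \<le> lagrangian X f g lam"
    if "X \<subseteq> assignments R" for lam
    unfolding lagrangian_def using that by (rule INF_superset_mono) simp
  have step: "shortest R (lagrangian_cost cbar \<gamma> K L lam) i S =
      (INF v \<in> controls M i S. ereal (cbar i (restrict S K) v + lam \<bullet> \<gamma> i (restrict S L) v) +
         shortest R (lagrangian_cost cbar \<gamma> K L lam) (Suc i) (\<rho> (Suc i) (trans M i S v)))"
    if "i < n" "S \<in> layer R i" for lam i S
    using shortest_step[of i M S \<rho> "lagrangian_cost cbar \<gamma> K L lam"] that
    by (simp add: R_def n_def lagrangian_cost_def del: plus_ereal.simps)
  have terminal: "shortest R w n S = 0" if "S \<in> layer R n" for w S
    using that shortest_terminal by (simp add: R_def n_def)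
  show ?thesis
    unfolding Let_def using len dual mono step terminal by (simp del: plus_ereal.simps)
qed

end
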